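(* Let $X=\{e_1,\ldots,e_m\}$ be a set of cardinality $m$, let $\mathcal S\subseteq 2^X$ be an arbitrary set family, let $d=\mathrm{VC\text{-}dim}_c^*(\mathcal S)$ be the clique-VC-dimension of $\mathcal S$, and let $G_{1,2}(\mathcal S)=(V,E)$ be the 1,2-inclusion graph of $\mathcal S$. Then $$\frac{|E|}{|V|}\le \binom{d}{2}.$$
   Context: The 1,2-inclusion graph $G_{1,2}(\mathcal S)$ has vertex set $\mathcal S$, and two sets $A,B\in\mathcal S$ are adjacent iff $1\le |A\triangle B|\le 2$. A set family is even if all its sets have even cardinality, and pointed if it contains $\varnothing$. For $A\subseteq X$, the twisting is $\mathcal S\triangle A:=\{S\triangle A: S\in\mathcal S\}$. For $Y'\subseteq Y\subseteq X$ let $Q[Y',Y]=\{Z\subseteq X: Y'\subseteq Z\subseteq Y\}$. For $Z\in Q[Y',Y]$, its fiber is $F(Z)=\{Z\cup Z': Z'\subseteq X\setminus Y\}$, and the projection of a family $\mathcal S$ is $\pi_{Q[Y',Y]}(\mathcal S)=\{Z\in Q[Y',Y]: F(Z)\cap\mathcal S\neq\varnothing\}$. For $Y\subset X$ and $e\in X\setminus Y$, let $P(e,Y)=\{\{e,y\}: y\in Y\}$ and $Q(e,Y)=Q[\{e\},Y\cup\{e\}]$. The pair $(e,Y)$ is c-shattered by $\mathcal S$ if there is a surjective map $f:\pi_{Q(e,Y)}(\mathcal S)\to P(e,Y)$ with $f(S)\subseteq S$ for every $S\in \pi_{Q(e,Y)}(\mathcal S)$. For a pointed even family $\mathcal S$,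 $\mathrm{VC\text{-}dim}_c(\mathcal S)=\max\{|Y|+1: Y\subset X \text{ and there is } e\in X\setminus Y \text{ such that } (e,Y) \text{ is c-shattered by } \mathcal S\}$. For an even family $\mathcal S$, $\mathrm{VC\text{-}dim}_c^*(\mathcal S)=\min\{\mathrm{VC\text{-}dim}_c(\mathcal S\triangle A): A\in\mathcal S\}$. For an arbitrary family $\mathcal S\subseteq 2^X$, its lifting $\mathcal S^+\subseteq 2^{X\cup\{e_{m+1}\}}$ consists of all sets of $\mathcal S$ of even size together with all sets $S\cup\{e_{m+1}\}$ for $S\in\mathcal S$ of odd size, where $e_{m+1}\notin X$ is a new element. Then $\mathrm{VC\text{-}dim}_c^*(\mathcal S):=\mathrm{VC\text{-}dim}_c^*(\mathcal S^+)$. *)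

theory Defs
  imports Complex_Main
begin

text \<open>
  The ground set \<open>X\<close> is an explicit parameter throughout, because fibers and dimensions
  depend on it and because lifting enlarges it.
\<close>

definition inclusion_graph_edges :: "'a set set \<Rightarrow> 'a set set set" where
  "inclusion_graph_edges \<S> =
     {{A, B} | A B. A \<in> \<S> \<and> B \<in> \<S> \<and> 1 \<le> card (sym_diff A B) \<and> card (sym_diff A B) \<le> 2}"

definition twisting :: "'a set set \<Rightarrow> 'a set \<Rightarrow> 'a set set" where
  "twisting \<S> A = (\<lambda>S. sym_diff S A) ` \<S>"

definition cube :: "'a set \<Rightarrow> 'a set \<Rightarrow> 'a set \<Rightarrow> 'a set set" where
  "cube X Y' Y = {Z. Z \<subseteq> X \<and> Y' \<subseteq> Z \<and> Z \<subseteq> Y}"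

text \<open>The fiber of \<open>Z \<in> cube X Y' Y\<close>; it depends on the cube only through \<open>Y\<close>.\<close>

definition fiber :: "'a set \<Rightarrow> 'a set \<Rightarrow> 'a set \<Rightarrow> 'a set set" where
  "fiber X Y Z = {Z \<union> Z' | Z'. Z' \<subseteq> X - Y}"

definition cube_projection :: "'a set \<Rightarrow> 'a set \<Rightarrow> 'a set \<Rightarrow> 'a set set \<Rightarrow> 'a set set" where
  "cube_projection X Y' Y \<S> = {Z \<in> cube X Y' Y. fiber X Y Z \<inter> \<S> \<noteq> {}}"

definition star_pairs :: "'a \<Rightarrow> 'a set \<Rightarrow> 'a set set" where
  "star_pairs e Y = {{e, y} | y. y \<in> Y}"

definition c_shattered :: "'a set \<Rightarrow> 'a set set \<Rightarrow> 'a \<Rightarrow> 'a set \<Rightarrow> bool" where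
  "c_shattered X \<S> e Y \<longleftrightarrow>
     (\<exists>f. f ` cube_projection X {e} (Y \<union> {e}) \<S> = star_pairs e Y \<and>
          (\<forall>S \<in> cube_projection X {e} (Y \<union> {e}) \<S>. f S \<subseteq> S))"

text \<open>Meaningful for pointed even families \<open>\<S> \<subseteq> Pow X\<close> with \<open>X\<close> finite and nonempty.\<close>

definition vc_dim_c :: "'a set \<Rightarrow> 'a set set \<Rightarrow> nat" where
  "vc_dim_c X \<S> = Max {card Y + 1 | Y. Y \<subset> X \<and> (\<exists>e \<in> X - Y. c_shattered X \<S> e Y)}"

text \<open>
  Meaningful for nonempty even families; every \<open>twisting \<S> A\<close> with \<open>A \<in> \<S>\<close> is then
  pointed and even.
\<close>

definition vc_dim_c_star_even :: "'a set \<Rightarrow> 'a set set \<Rightarrow> nat" where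
  "vc_dim_c_star_even X \<S> = Min {vc_dim_c X (twisting \<S> A) | A. A \<in> \<S>}"

text \<open>
  The new element of the lifted ground set is \<open>None\<close>; an old element \<open>x\<close> becomes \<open>Some x\<close>.
\<close>

definition lifting_ground :: "'a set \<Rightarrow> 'a option set" where
  "lifting_ground X = insert None (Some ` X)"

definition lifting :: "'a set set \<Rightarrow> 'a option set set" where
  "lifting \<S> = {Some ` S | S. S \<in> \<S> \<and> even (card S)} \<union>
               {insert None (Some ` S) | S. S \<in> \<S> \<and> odd (card S)}"

definition clique_vc_dim :: "'a set \<Rightarrow> 'a set set \<Rightarrow> nat" where
  "clique_vc_dim X \<S> = vc_dim_c_star_even (lifting_ground X) (lifting \<S>)"

end

theory Submission
  imports Defs
begin

text \<open>
  It suffices to treat a pointed even family \<open>\<S>\<close>, since twisting and lifting are injective and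
  preserve adjacency. Fix \<open>e\<close> and choose \<open>Y\<close> of maximal size such that distinct traces on \<open>Y\<close> of
  sets containing \<open>e\<close> can be assigned to the elements of \<open>Y\<close>, each trace containing its element.
  By an exchange argument, maximality forces the sets containing \<open>e\<close> to have pairwise distinct,
  nonempty traces on \<open>Y\<close>. Hence \<open>(e, Y)\<close> is c-shattered, and a set \<open>A \<ni> e\<close> has at most
  \<open>|Y| + (|Y| choose 2) \<le> K := (d choose 2)\<close> neighbours containing \<open>e\<close>, and at most \<open>K - 1\<close> if
  \<open>|A| = 2\<close>. Summing over \<open>e \<in> A\<close> counts a neighbour \<open>B\<close> of \<open>A\<close> exactly \<open>|A \<inter> B|\<close> times, which
  gives \<open>deg A \<le> 2 K\<close>, improved to \<open>2 K - 1\<close> for pairs. The gain on pairs pays for the degree of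
  the empty set, which is the number of pairs.
\<close>

section \<open>Neighbourhoods, systems of representatives, symmetric differences\<close>

definition nbrs :: "'a set set \<Rightarrow> 'a set \<Rightarrow> 'a set set" where
  "nbrs \<S> A = {B \<in> \<S>. 1 \<le> card (sym_diff A B) \<and> card (sym_diff A B) \<le> 2}"

text \<open>\<open>g\<close> chooses whole sets rather than traces, so that the same choice can be
  read on a larger \<open>Y\<close>; injectivity is asked of the traces.\<close>

definition rep_by :: "'a set set \<Rightarrow> 'a \<Rightarrow> ('a \<Rightarrow> 'a set) \<Rightarrow> 'a set \<Rightarrow> bool" where
  "rep_by \<S> e g Y \<longleftrightarrow>
     (\<forall>y\<in>Y. g y \<in> \<S> \<and> e \<in> g y \<and> y \<in> g y) \<and> inj_on (\<lambda>y. g y \<inter> Y) Y"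

lemma card_add_eq_card_sym_diff:
  assumes "finite A" "finite B"
  shows "card A + card B = card (sym_diff A B) + 2 * card (A \<inter> B)"
proof -
  have "card (sym_diff A B) = card (A - B) + card (B - A)"
    using assms by (intro card_Un_disjoint) auto
  moreover have "card A = card (A - B) + card (A \<inter> B)"
    using assms(1) card_Int_Diff[of A B] by simp
  moreover have "card B = card (B - A) + card (A \<inter> B)"
    using assms(2) card_Int_Diff[of B A] by (simp add: Int_commute)
  ultimately show ?thesis by simp
qed

lemma even_card_sym_diff:
  assumes "finite A" "finite B"
  shows "even (card (sym_diff A B)) \<longleftrightarrow> (even (card A) \<longleftrightarrow> even (card B))"
  using card_add_eq_card_sym_diff[OF assms] by presburger

section \<open>Enlarging a system of representatives\<close>

lemma inj_on_Int_insert: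
  assumes "inj_on (\<lambda>y. g y \<inter> Y) Y"
  shows "inj_on (\<lambda>y. g y \<inter> insert z Y) Y"
proof (rule inj_onI)
  fix x y assume "x \<in> Y" "y \<in> Y" "g x \<inter> insert z Y = g y \<inter> insert z Y"
  then show "x = y" by (intro inj_onD[OF assms]) auto
qed

text \<open>Old traces stay distinct on a larger \<open>Y\<close>, so the only possible clash is
  between the new trace and an old one.\<close>

lemma rep_by_insert:
  assumes rep: "rep_by \<S> e g Y" and A: "A \<in> \<S>" "e \<in> A" "z \<in> A" and z: "z \<notin> Y"
    and new: "\<And>y. y \<in> Y \<Longrightarrow> g y \<inter> insert z Y \<noteq> A \<inter> insert z Y"
  shows "rep_by \<S> e (g(z := A)) (insert z Y)"
proof -
  have "inj_on (\<lambda>y. g y \<inter> insert z Y) Y"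
    using rep unfolding rep_by_def by (blast intro: inj_on_Int_insert)
  then have "inj_on (\<lambda>y. (g(z := A)) y \<inter> insert z Y) Y"
    using z by (auto simp: inj_on_def)
  then have "inj_on (\<lambda>y. (g(z := A)) y \<inter> insert z Y) (insert z Y)"
    using z new by (auto simp: inj_on_insert image_iff)
  then show ?thesis using rep A z unfolding rep_by_def by auto
qed

text \<open>Each old trace contains its own element of \<open>Y\<close>, whereas \<open>A\<close>
  misses \<open>Y\<close>, so no clash can occur.\<close>

lemma rep_by_extend_miss:
  assumes rep: "rep_by \<S> e g Y" and A: "A \<in> \<S>" "e \<in> A" "A \<inter> Y = {}" and z: "z \<in> A"
  shows "rep_by \<S> e (g(z := A)) (insert z Y)"
proof (rule rep_by_insert[OF rep A(1,2) z])
  show "z \<notin> Y" using A z by auto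
  fix y assume "y \<in> Y"
  then have "y \<in> g y" using rep unfolding rep_by_def by auto
  then show "g y \<inter> insert z Y \<noteq> A \<inter> insert z Y" using \<open>y \<in> Y\<close> A by blast
qed

lemma rep_by_extend_collision:
  assumes rep: "rep_by \<S> e g Y" and A: "A \<in> \<S>" "e \<in> A" and B: "B \<in> \<S>" "e \<in> B"
    and eq: "A \<inter> Y = B \<inter> Y" and z: "z \<in> A" "z \<notin> B"
  shows "\<exists>g'. rep_by \<S> e g' (insert z Y)"
proof (cases "\<exists>y\<in>Y. g y \<inter> insert z Y = A \<inter> insert z Y")
  case False
  moreover have "z \<notin> Y" using eq z by auto
  ultimately show ?thesis using rep_by_insert[OF rep A z(1)] by blast
next
  \<comment> \<open>The trace of \<open>A\<close> is already assigned to some \<open>y\<close>: give \<open>y\<close> the trace of \<open>B\<close> instead.\<close>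
  case True
  then obtain y where y: "y \<in> Y" "g y \<inter> insert z Y = A \<inter> insert z Y" by blast
  then have yY: "g y \<inter> Y = A \<inter> Y" by blast
  have zY: "z \<notin> Y" using eq z by auto
  let ?g = "g(y := B)"
  \<comment> \<open>Since \<open>g y\<close>, \<open>A\<close> and \<open>B\<close> agree on
    \<open>Y\<close>, the exchange changes no trace on \<open>Y\<close> and the system stays
    valid.\<close>
  have trace: "?g x \<inter> Y = g x \<inter> Y" for x using yY eq by auto
  have rep': "rep_by \<S> e ?g Y"
    unfolding rep_by_def trace
  proof (intro conjI ballI)
    fix x assume x: "x \<in> Y"
    show "?g x \<in> \<S>" "e \<in> ?g x" using rep x B unfolding rep_by_def by auto
    have "x \<in> g x" using rep x unfolding rep_by_def by auto
    then show "x \<in> ?g x" using trace[of x] x by blast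
  qed (use rep in \<open>simp add: rep_by_def\<close>)
  \<comment> \<open>At \<open>y\<close> the sets \<open>B\<close> and \<open>A\<close> differ in
    \<open>z\<close>; at any other element the trace differs from that of \<open>A\<close> already
    on \<open>Y\<close>.\<close>
  have "?g x \<inter> insert z Y \<noteq> A \<inter> insert z Y" if x: "x \<in> Y" for x
  proof (cases "x = y")
    case True
    then show ?thesis using z by auto
  next
    case False
    then have "g x \<inter> Y \<noteq> g y \<inter> Y" using rep x y(1) unfolding rep_by_def inj_on_def by blast
    then show ?thesis using False yY by auto
  qed
  from rep_by_insert[OF rep' A z(1) zY this] show ?thesis by blast
qed

section \<open>From systems of representatives to c-shattering\<close>

lemma cube_projection_star:
  assumes "\<S> \<subseteq> Pow X"
  shows "cube_projection X {e} (Y \<union> {e}) \<S> = (\<lambda>A. A \<inter> insert e Y) ` {A \<in> \<S>. e \<in> A}"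
proof (intro equalityI subsetI)
  fix Z assume "Z \<in> cube_projection X {e} (Y \<union> {e}) \<S>"
  then obtain Z' where Z': "Z' \<subseteq> X - (Y \<union> {e})" "Z \<union> Z' \<in> \<S>"
    and Z: "e \<in> Z" "Z \<subseteq> Y \<union> {e}"
    unfolding cube_projection_def cube_def fiber_def by blast
  then have "Z = (Z \<union> Z') \<inter> insert e Y" by blast
  then show "Z \<in> (\<lambda>A. A \<inter> insert e Y) ` {A \<in> \<S>. e \<in> A}"
    using Z Z' by blast
next
  fix Z assume "Z \<in> (\<lambda>A. A \<inter> insert e Y) ` {A \<in> \<S>. e \<in> A}"
  then obtain A where A: "A \<in> \<S>" "e \<in> A" "Z = A \<inter> insert e Y" by blast
  then have "A = Z \<union> (A - (Y \<union> {e}))" "A - (Y \<union> {e}) \<subseteq> X - (Y \<union> {e})"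
    using assms by auto
  then have "A \<in> fiber X (Y \<union> {e}) Z" unfolding fiber_def by blast
  moreover have "Z \<in> cube X {e} (Y \<union> {e})" using A assms by (auto simp: cube_def)
  ultimately show "Z \<in> cube_projection X {e} (Y \<union> {e}) \<S>"
    using A(1) unfolding cube_projection_def by blast
qed

text \<open>Sending each assigned trace to its own element gives surjectivity; every other trace
  meets \<open>Y\<close> and goes to an arbitrary element of the intersection.\<close>

lemma rep_by_imp_c_shattered:
  assumes S: "\<S> \<subseteq> Pow X" and rep: "rep_by \<S> e g Y"
    and hit: "\<And>A. A \<in> \<S> \<Longrightarrow> e \<in> A \<Longrightarrow> A \<inter> Y \<noteq> {}"
  shows "c_shattered X \<S> e Y"
proof -
  \<comment> \<open>The trace is taken on \<open>insert e Y\<close> because the members of the cube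
    contain \<open>e\<close>; injectivity carries over from \<open>Y\<close>.\<close>
  define t where "t y = g y \<inter> insert e Y" for y
  define h where "h Z = (if Z \<in> t ` Y then inv_into Y t Z else SOME y. y \<in> Z \<inter> Y)" for Z
  have inj: "inj_on t Y"
    using rep unfolding rep_by_def t_def by (blast intro: inj_on_Int_insert)
  let ?P = "(\<lambda>A. A \<inter> insert e Y) ` {A \<in> \<S>. e \<in> A}"
  have h: "h Z \<in> Z \<inter> Y" if Z: "Z \<in> ?P" for Z
  proof (cases "Z \<in> t ` Y")
    case True
    then obtain y where y: "y \<in> Y" "Z = t y" by blast
    then have "h Z = y" using inj unfolding h_def by simp
    then show ?thesis using y rep unfolding rep_by_def t_def by auto
  next
    case False
    obtain A where A: "A \<in> \<S>" "e \<in> A" "Z = A \<inter> insert e Y" using Z by blast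
    have "\<exists>y. y \<in> Z \<inter> Y" using hit[OF A(1,2)] A(3) by blast
    then have "(SOME y. y \<in> Z \<inter> Y) \<in> Z \<inter> Y" by (rule someI_ex)
    then show ?thesis using False unfolding h_def by simp
  qed
  have ht: "h (t y) = y" "t y \<in> ?P" if "y \<in> Y" for y
  proof -
    show "h (t y) = y" using that inj unfolding h_def by simp
    show "t y \<in> ?P" using that rep unfolding rep_by_def t_def by blast
  qed
  have "(\<lambda>Z. {e, h Z}) ` ?P = star_pairs e Y"
  proof (intro equalityI subsetI)
    fix p assume "p \<in> (\<lambda>Z. {e, h Z}) ` ?P"
    then show "p \<in> star_pairs e Y" using h unfolding star_pairs_def by blast
  next
    fix p assume "p \<in> star_pairs e Y"
    then obtain y where "y \<in> Y" "p = {e, y}" unfolding star_pairs_def by blast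
    then show "p \<in> (\<lambda>Z. {e, h Z}) ` ?P" using ht by (metis (no_types, lifting) imageI)
  qed
  moreover have "\<forall>Z\<in>?P. {e, h Z} \<subseteq> Z" using h by blast
  ultimately show ?thesis
    unfolding c_shattered_def cube_projection_star[OF S] by blast
qed

lemma card_le_vc_dim_c:
  assumes "finite X" "Y \<subseteq> X" "e \<in> X - Y" "c_shattered X \<S> e Y"
  shows "card Y + 1 \<le> vc_dim_c X \<S>"
  unfolding vc_dim_c_def
proof (rule Max_ge)
  have "{card Y + 1 | Y. Y \<subset> X \<and> (\<exists>e \<in> X - Y. c_shattered X \<S> e Y)}
      \<subseteq> (\<lambda>Y. card Y + 1) ` Pow X" by blast
  then show "finite {card Y + 1 | Y. Y \<subset> X \<and> (\<exists>e \<in> X - Y. c_shattered X \<S> e Y)}"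
    using assms(1) by (meson finite_Pow_iff finite_imageI finite_subset)
qed (use assms in blast)

text \<open>A largest \<open>Y\<close> with a system of representatives works: a set missing
  \<open>Y\<close>, or two sets with the same trace, would allow an enlargement.\<close>

lemma ex_separating_transversal:
  assumes fin: "finite X" and S: "\<S> \<subseteq> Pow X" and even: "\<And>A. A \<in> \<S> \<Longrightarrow> even (card A)"
    and e: "e \<in> X"
  obtains Y where "Y \<subseteq> X - {e}" "card Y + 1 \<le> vc_dim_c X \<S>"
    "\<forall>A\<in>\<S>. e \<in> A \<longrightarrow> A \<inter> Y \<noteq> {}"
    "inj_on (\<lambda>A. A \<inter> Y) {A \<in> \<S>. e \<in> A}"
proof -
  let ?R = "\<lambda>Y. Y \<subseteq> X - {e} \<and> (\<exists>g. rep_by \<S> e g Y)"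
  have "?R {}" by (simp add: rep_by_def)
  moreover have "\<forall>Y. ?R Y \<longrightarrow> card Y < Suc (card X)"
    using card_mono[OF fin] by (blast intro: le_imp_less_Suc)
  ultimately have "\<exists>Y. ?R Y \<and> (\<forall>Y'. ?R Y' \<longrightarrow> card Y' \<le> card Y)"
    by (rule Lattices_Big.ex_has_greatest_nat)
  then obtain Y where Y: "?R Y" and max: "\<And>Y'. ?R Y' \<Longrightarrow> card Y' \<le> card Y"
    by (elim exE conjE) metis
  from Y obtain g where g: "rep_by \<S> e g Y" by blast
  have finY: "finite Y" using Y fin by (meson finite_Diff finite_subset)
  have maximal: "\<not> rep_by \<S> e g' (insert z Y)" if "z \<in> X - {e}" "z \<notin> Y" for z g'
    using max[of "insert z Y"] that Y finY by auto
  have hit: "A \<inter> Y \<noteq> {}" if A: "A \<in> \<S>" "e \<in> A" for A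
  proof
    assume miss: "A \<inter> Y = {}"
    \<comment> \<open>Evenness excludes the singleton, so \<open>A\<close> has a further element by
      which \<open>Y\<close> could grow.\<close>
    have "A \<noteq> {e}" using even[OF A(1)] by auto
    then obtain z where z: "z \<in> A" "z \<noteq> e" using A(2) by blast
    then have "z \<in> X - {e}" "z \<notin> Y" using A S miss by auto
    with maximal rep_by_extend_miss[OF g A miss z(1)] show False by blast
  qed
  have sub: "A \<subseteq> B" if A: "A \<in> \<S>" "e \<in> A" and B: "B \<in> \<S>" "e \<in> B" and eq: "A \<inter> Y = B \<inter> Y"
    for A B
  proof
    fix z assume z: "z \<in> A"
    show "z \<in> B"
    proof (rule ccontr)
      assume nz: "z \<notin> B"
      then have "z \<in> X - {e}" "z \<notin> Y" using A B S z eq by auto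
      with maximal rep_by_extend_collision[OF g A B eq z nz] show False by blast
    qed
  qed
  show thesis
  proof (rule that)
    show "Y \<subseteq> X - {e}" using Y by blast
    show "card Y + 1 \<le> vc_dim_c X \<S>"
      using Y e by (intro card_le_vc_dim_c[OF fin _ _ rep_by_imp_c_shattered[OF S g hit]]) auto
    show "inj_on (\<lambda>A. A \<inter> Y) {A \<in> \<S>. e \<in> A}"
    proof (rule inj_onI)
      fix A B assume "A \<in> {A \<in> \<S>. e \<in> A}" "B \<in> {A \<in> \<S>. e \<in> A}" "A \<inter> Y = B \<inter> Y"
      then show "A = B" using sub[of A B] sub[of B A] by simp
    qed
  qed (use hit in blast)
qed

section \<open>Degree bounds\<close>

lemma card_one_two_subsets:
  assumes "finite Y"
  shows "card {Z. Z \<subseteq> Y \<and> 1 \<le> card Z \<and> card Z \<le> 2} = (card Y + 1) choose 2"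
proof -
  have fin: "finite {Z. Z \<subseteq> Y \<and> card Z = k}" for k using assms by simp
  have "{Z. Z \<subseteq> Y \<and> 1 \<le> card Z \<and> card Z \<le> 2} =
      {Z. Z \<subseteq> Y \<and> card Z = 1} \<union> {Z. Z \<subseteq> Y \<and> card Z = 2}" by auto
  then have "card {Z. Z \<subseteq> Y \<and> 1 \<le> card Z \<and> card Z \<le> 2} =
      card {Z. Z \<subseteq> Y \<and> card Z = 1} + card {Z. Z \<subseteq> Y \<and> card Z = 2}"
    by (simp only:) (rule card_Un_disjoint[OF fin fin], auto)
  also have "\<dots> = (card Y + 1) choose 2"
    unfolding n_subsets[OF assms] by (simp add: numeral_2_eq_2)
  finally show ?thesis .
qed

text \<open>Neighbours of \<open>A\<close> through \<open>e\<close> are told apart by how their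
  traces on \<open>Y\<close> differ from that of \<open>A\<close>. These differences are nonempty
  subsets of \<open>Y\<close> of size at most 2, and \<open>card Y + 1\<close> is at most the
  dimension.\<close>

lemma card_star_nbrs_le:
  assumes fin: "finite X" and S: "\<S> \<subseteq> Pow X" and even: "\<And>A. A \<in> \<S> \<Longrightarrow> even (card A)"
    and A: "A \<in> \<S>" "e \<in> A"
  shows "card {B \<in> nbrs \<S> A. e \<in> B} + (if card A = 2 then 1 else 0) \<le> vc_dim_c X \<S> choose 2"
proof -
  have eX: "e \<in> X" using A S by blast
  obtain Y where Y: "Y \<subseteq> X - {e}" "card Y + 1 \<le> vc_dim_c X \<S>"
    and hit: "\<forall>A\<in>\<S>. e \<in> A \<longrightarrow> A \<inter> Y \<noteq> {}"
    and inj: "inj_on (\<lambda>A. A \<inter> Y) {A \<in> \<S>. e \<in> A}"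
    by (rule ex_separating_transversal[OF fin S even eX])
  have finY: "finite Y" using Y fin by (meson finite_Diff finite_subset)
  let ?M = "{B \<in> nbrs \<S> A. e \<in> B}"
  let ?\<phi> = "\<lambda>B. sym_diff (A \<inter> Y) (B \<inter> Y)"
  let ?T = "{Z. Z \<subseteq> Y \<and> 1 \<le> card Z \<and> card Z \<le> 2}"
  have finT: "finite ?T" using finY by simp
  have inj\<phi>: "inj_on ?\<phi> ?M"
  proof (rule inj_onI)
    fix B C assume B: "B \<in> ?M" and C: "C \<in> ?M" and "?\<phi> B = ?\<phi> C"
    then have "B \<inter> Y = C \<inter> Y" by blast
    then show "B = C" using B C inj by (auto simp: nbrs_def inj_on_def)
  qed
  have im: "?\<phi> ` ?M \<subseteq> ?T"
  proof
    fix Z assume "Z \<in> ?\<phi> ` ?M"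
    then obtain B where B: "B \<in> ?M" and Z: "Z = ?\<phi> B" by blast
    have finAB: "finite (sym_diff A B)"
      using A B S fin by (auto simp: nbrs_def intro: finite_subset)
    have "A \<noteq> B" using B by (auto simp: nbrs_def)
    then have "A \<inter> Y \<noteq> B \<inter> Y" using A B inj by (auto simp: nbrs_def inj_on_def)
    then have "Z \<noteq> {}" using Z by blast
    moreover have ZY: "Z \<subseteq> Y" using Z by blast
    ultimately have "1 \<le> card Z" using finY by (metis One_nat_def Suc_leI card_gt_0_iff finite_subset)
    moreover have "card Z \<le> card (sym_diff A B)"
      using Z by (intro card_mono[OF finAB]) blast
    ultimately show "Z \<in> ?T" using ZY B by (auto simp: nbrs_def)
  qed
  have le: "card ?T \<le> vc_dim_c X \<S> choose 2"
    unfolding card_one_two_subsets[OF finY] using Y(2) by (rule binomial_right_mono)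
  show ?thesis
  proof (cases "card A = 2")
    case False
    then show ?thesis using le card_inj_on_le[OF inj\<phi> im finT] by simp
  next
    \<comment> \<open>The trace of the pair \<open>A\<close> is a singleton \<open>{b}\<close>, and no neighbour has the empty trace.\<close>
    case True
    then obtain b where b: "A = {e, b}" using A(2) by (auto simp: card_2_iff)
    then have bY: "A \<inter> Y = {b}" using hit A Y by fastforce
    have "{b} \<notin> ?\<phi> ` ?M"
    proof
      assume "{b} \<in> ?\<phi> ` ?M"
      then obtain B where B: "B \<in> ?M" "{b} = ?\<phi> B" by blast
      then have "B \<inter> Y = {}" unfolding bY by blast
      then show False using hit B by (auto simp: nbrs_def)
    qed
    moreover have "{b} \<in> ?T" using bY by auto
    ultimately have "?\<phi> ` ?M \<subset> ?T" using im by blast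
    then have "card (?\<phi> ` ?M) < card ?T" using finT by (rule psubset_card_mono[rotated])
    then show ?thesis using le True card_image[OF inj\<phi>] by simp
  qed
qed

lemma sum_card_containing:
  assumes "finite A" "finite \<N>"
  shows "(\<Sum>e\<in>A. card {B \<in> \<N>. e \<in> B}) = (\<Sum>B\<in>\<N>. card (A \<inter> B))"
proof -
  have "(\<Sum>e\<in>A. card {B \<in> \<N>. e \<in> B}) = (\<Sum>e\<in>A. \<Sum>B | B \<in> \<N> \<and> e \<in> B. 1)" by simp
  also have "\<dots> = (\<Sum>B\<in>\<N>. \<Sum>e | e \<in> A \<and> e \<in> B. 1)"
    by (rule sum.swap_restrict[OF assms])
  also have "\<dots> = (\<Sum>B\<in>\<N>. card (A \<inter> B))" by (simp add: Int_def)
  finally show ?thesis .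
qed

text \<open>Summing the bounds at the elements of \<open>A\<close> counts each neighbour
  \<open>B\<close> with weight \<open>card (A \<inter> B)\<close>, so the task is to bound this
  weight from below.\<close>

lemma card_nbrs_le:
  assumes fin: "finite X" and S: "\<S> \<subseteq> Pow X" and even: "\<And>A. A \<in> \<S> \<Longrightarrow> even (card A)"
    and A: "A \<in> \<S>" "A \<noteq> {}"
  shows "card (nbrs \<S> A) + (if card A = 2 then 1 else 0) \<le> 2 * (vc_dim_c X \<S> choose 2)"
proof -
  let ?K = "vc_dim_c X \<S> choose 2"
  let ?N = "nbrs \<S> A"
  have finS: "finite \<S>" using S fin by (meson finite_Pow_iff finite_subset)
  have fins: "finite B" if "B \<in> \<S>" for B using that S fin by (auto intro: finite_subset)
  have finN: "finite ?N" using finS by (simp add: nbrs_def)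
  note finA = fins[OF A(1)]
  have star: "card {B \<in> ?N. e \<in> B} + (if card A = 2 then 1 else 0) \<le> ?K" if "e \<in> A" for e
    using card_star_nbrs_le[OF fin S even A(1) that] .
  have "card A \<noteq> 0" using A(2) finA by simp
  then have "card A = 2 \<or> 4 \<le> card A" using even[OF A(1)] by presburger
  then consider "card A = 2" | "4 \<le> card A" by blast
  then show ?thesis
  proof cases
    case 1
    let ?N' = "?N - {{}}"
    \<comment> \<open>A neighbour disjoint from the pair \<open>A\<close> satisfies
      \<open>card B + 2 \<le> 2\<close>, so only the empty set has weight zero. It is set aside and
      costs one at the end.\<close>
    have "1 \<le> card (A \<inter> B)" if B: "B \<in> ?N'" for B
    proof (rule ccontr)
      assume "\<not> 1 \<le> card (A \<inter> B)"
      then have "card (A \<inter> B) = 0" by simp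
      moreover have BS: "B \<in> \<S>" using B by (simp add: nbrs_def)
      moreover have "card (sym_diff A B) \<le> 2" using B by (simp add: nbrs_def)
      ultimately have "card B = 0"
        using card_add_eq_card_sym_diff[OF finA fins[OF BS]] 1 by linarith
      then show False using fins[OF BS] B by simp
    qed
    then have "(\<Sum>B\<in>?N'. 1) \<le> (\<Sum>B\<in>?N'. card (A \<inter> B))" by (rule sum_mono)
    then have "card ?N' \<le> (\<Sum>e\<in>A. card {B \<in> ?N'. e \<in> B})"
      using sum_card_containing[OF finA, of ?N'] finN by simp
    also have "\<dots> \<le> (\<Sum>e\<in>A. ?K - 1)"
    proof (rule sum_mono)
      fix e assume e: "e \<in> A"
      have "card {B \<in> ?N'. e \<in> B} \<le> card {B \<in> ?N. e \<in> B}"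
        using finN by (intro card_mono) auto
      then show "card {B \<in> ?N'. e \<in> B} \<le> ?K - 1" using star[OF e] 1 by simp
    qed
    also have "\<dots> = 2 * (?K - 1)" using 1 by simp
    finally have "card ?N' \<le> 2 * (?K - 1)" .
    moreover have "card ?N \<le> card ?N' + 1"
      using finN by (cases "{} \<in> ?N") (auto simp: card_Diff_singleton)
    moreover obtain e where "e \<in> A" using A(2) by blast
    \<comment> \<open>Subtraction on naturals truncates, so \<open>2 * (?K - 1) + 2 = 2 * ?K\<close>
      requires \<open>?K\<close> to be positive.\<close>
    then have "1 \<le> ?K" using star 1 by fastforce
    ultimately show ?thesis using 1 by simp
  next
    case 2
    have "card A - 2 \<le> card (A \<inter> B)" if B: "B \<in> ?N" for B
    proof -
      have BS: "B \<in> \<S>" using B by (simp add: nbrs_def)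
      have "card (A - B) \<le> card (sym_diff A B)"
        using finA fins[OF BS] by (intro card_mono) auto
      moreover have "card (sym_diff A B) \<le> 2" using B by (simp add: nbrs_def)
      ultimately show ?thesis using card_Int_Diff[OF finA, of B] by linarith
    qed
    then have "(\<Sum>B\<in>?N. card A - 2) \<le> (\<Sum>B\<in>?N. card (A \<inter> B))" by (rule sum_mono)
    then have "card ?N * (card A - 2) \<le> (\<Sum>e\<in>A. card {B \<in> ?N. e \<in> B})"
      using sum_card_containing[OF finA finN] by simp
    also have "\<dots> \<le> (\<Sum>e\<in>A. ?K)"
      using star by (intro sum_mono) (use 2 in auto)
    also have "\<dots> = card A * ?K" by simp
    \<comment> \<open>Here \<open>4 \<le> card A\<close> is what gives
      \<open>card A \<le> 2 * (card A - 2)\<close>; the positive factor \<open>card A - 2\<close>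
      then cancels.\<close>
    also have "\<dots> \<le> (2 * (card A - 2)) * ?K" using 2 by (intro mult_right_mono) auto
    also have "\<dots> = (2 * ?K) * (card A - 2)" by simp
    finally have "card ?N \<le> 2 * ?K" using 2 by simp
    then show ?thesis using 2 by simp
  qed
qed

section \<open>Counting edges of a pointed even family\<close>

lemma finite_inclusion_graph_edges:
  assumes "finite \<S>"
  shows "finite (inclusion_graph_edges \<S>)"
proof -
  have "inclusion_graph_edges \<S> \<subseteq> Pow \<S>" unfolding inclusion_graph_edges_def by auto
  then show ?thesis using assms by (meson finite_Pow_iff finite_subset)
qed

text \<open>Edges are two-element sets of vertices, so exchanging the sums over vertices and edges
  counts incidences; each edge at \<open>A\<close> comes from a neighbour of
  \<open>A\<close>.\<close>

lemma handshake_inclusion_graph: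
  assumes "finite \<S>"
  shows "2 * card (inclusion_graph_edges \<S>) \<le> (\<Sum>A\<in>\<S>. card (nbrs \<S> A))"
proof -
  let ?E = "inclusion_graph_edges \<S>"
  have finE: "finite ?E" using assms by (rule finite_inclusion_graph_edges)
  have two: "card (\<S> \<inter> p) = 2" if p: "p \<in> ?E" for p
  proof -
    obtain A B where AB: "p = {A, B}" "A \<in> \<S>" "B \<in> \<S>" "1 \<le> card (sym_diff A B)"
      using p unfolding inclusion_graph_edges_def by blast
    then have "A \<noteq> B" by auto
    moreover have "\<S> \<inter> p = {A, B}" using AB by blast
    ultimately show ?thesis by simp
  qed
  have "2 * card ?E = (\<Sum>p\<in>?E. card (\<S> \<inter> p))" using two by simp
  also have "\<dots> = (\<Sum>A\<in>\<S>. card {p \<in> ?E. A \<in> p})"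
    by (rule sum_card_containing[OF assms finE, symmetric])
  also have "\<dots> \<le> (\<Sum>A\<in>\<S>. card (nbrs \<S> A))"
  proof (rule sum_mono)
    fix A assume "A \<in> \<S>"
    have finN: "finite (nbrs \<S> A)" using assms by (simp add: nbrs_def)
    have "{p \<in> ?E. A \<in> p} \<subseteq> (\<lambda>B. {A, B}) ` nbrs \<S> A"
    proof
      fix p assume "p \<in> {p \<in> ?E. A \<in> p}"
      then obtain C D where p: "p = {C, D}" "C \<in> \<S>" "D \<in> \<S>" "A = C \<or> A = D"
        and c: "1 \<le> card (sym_diff C D)" "card (sym_diff C D) \<le> 2"
        unfolding inclusion_graph_edges_def by blast
      from p(4) show "p \<in> (\<lambda>B. {A, B}) ` nbrs \<S> A"
      proof
        assume "A = C"
        then show ?thesis using p c by (auto simp: nbrs_def)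
      next
        assume "A = D"
        then show ?thesis using p c
          by (intro image_eqI[of _ _ C]) (auto simp: nbrs_def Un_commute)
      qed
    qed
    then show "card {p \<in> ?E. A \<in> p} \<le> card (nbrs \<S> A)"
      using finN by (meson card_image_le card_mono finite_imageI order_trans)
  qed
  finally show ?thesis .
qed

text \<open>The empty set has no degree bound of its own, but by evenness all its neighbours are
  pairs, and each pair has one unit to spare in its bound.\<close>

lemma card_edges_pointed_even_le:
  assumes fin: "finite X" and S: "\<S> \<subseteq> Pow X" and even: "\<And>A. A \<in> \<S> \<Longrightarrow> even (card A)"
    and pointed: "{} \<in> \<S>"
  shows "card (inclusion_graph_edges \<S>) \<le> (vc_dim_c X \<S> choose 2) * card \<S>"
proof -
  let ?K = "vc_dim_c X \<S> choose 2"
  let ?S = "\<S> - {{}}"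
  have finS: "finite \<S>" using S fin by (meson finite_Pow_iff finite_subset)
  have "nbrs \<S> {} \<subseteq> {A \<in> ?S. card A = 2}"
  proof
    fix A assume A: "A \<in> nbrs \<S> {}"
    then have "A \<in> \<S>" "1 \<le> card A" "card A \<le> 2" by (auto simp: nbrs_def)
    moreover from this have "card A \<noteq> 1" using even by (metis odd_one)
    ultimately show "A \<in> {A \<in> ?S. card A = 2}" by auto
  qed
  then have "card (nbrs \<S> {}) \<le> card {A \<in> ?S. card A = 2}"
    using finS by (intro card_mono) auto
  \<comment> \<open>Written as a sum of indicators, the degree of the empty set can be merged
    termwise with the other degrees.\<close>
  also have "\<dots> = (\<Sum>A\<in>?S. if card A = 2 then 1 else 0)"
    using finS by (simp add: sum.If_cases Int_def)
  finally have empty: "card (nbrs \<S> {}) \<le> (\<Sum>A\<in>?S. if card A = 2 then 1 else 0)" .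
  have "2 * card (inclusion_graph_edges \<S>) \<le> (\<Sum>A\<in>\<S>. card (nbrs \<S> A))"
    by (rule handshake_inclusion_graph[OF finS])
  also have "\<dots> = card (nbrs \<S> {}) + (\<Sum>A\<in>?S. card (nbrs \<S> A))"
    by (rule sum.remove[OF finS pointed])
  also have "\<dots> \<le> (\<Sum>A\<in>?S. card (nbrs \<S> A) + (if card A = 2 then 1 else 0))"
    using empty by (simp add: sum.distrib)
  also have "\<dots> \<le> (\<Sum>A\<in>?S. 2 * ?K)"
    using card_nbrs_le[OF fin S even] by (intro sum_mono) auto
  also have "\<dots> \<le> (\<Sum>A\<in>\<S>. 2 * ?K)"
    using finS by (intro sum_mono2) auto
  finally show ?thesis by (simp add: mult.commute)
qed

section \<open>Removing pointedness by twisting\<close>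

lemma card_edges_le_image:
  assumes fin: "finite \<S>" and inj: "inj_on \<phi> \<S>"
    and adj: "\<And>A B. A \<in> \<S> \<Longrightarrow> B \<in> \<S> \<Longrightarrow> 1 \<le> card (sym_diff A B) \<Longrightarrow> card (sym_diff A B) \<le> 2 \<Longrightarrow>
      1 \<le> card (sym_diff (\<phi> A) (\<phi> B)) \<and> card (sym_diff (\<phi> A) (\<phi> B)) \<le> 2"
  shows "card (inclusion_graph_edges \<S>) \<le> card (inclusion_graph_edges (\<phi> ` \<S>))"
proof (rule card_inj_on_le)
  have "inclusion_graph_edges \<S> \<subseteq> Pow \<S>" unfolding inclusion_graph_edges_def by auto
  then show "inj_on ((`) \<phi>) (inclusion_graph_edges \<S>)"
    using inj_on_image_Pow[OF inj] inj_on_subset by blast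
  show "(`) \<phi> ` inclusion_graph_edges \<S> \<subseteq> inclusion_graph_edges (\<phi> ` \<S>)"
  proof
    fix q assume "q \<in> (`) \<phi> ` inclusion_graph_edges \<S>"
    then obtain A B where "q = {\<phi> A, \<phi> B}" "A \<in> \<S>" "B \<in> \<S>"
      "1 \<le> card (sym_diff A B)" "card (sym_diff A B) \<le> 2"
      unfolding inclusion_graph_edges_def by auto
    with adj[of A B] show "q \<in> inclusion_graph_edges (\<phi> ` \<S>)"
      unfolding inclusion_graph_edges_def by blast
  qed
qed (use fin in \<open>simp add: finite_inclusion_graph_edges\<close>)

lemma sym_diff_sym_diff_cancel: "sym_diff (sym_diff A T) (sym_diff B T) = sym_diff A B"
  by blast

lemma inj_sym_diff: "inj_on (\<lambda>A. sym_diff A T) \<S>"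
  by (rule inj_onI) blast

text \<open>The minimum over twistings is attained at some member \<open>T\<close>. Twisting by
  \<open>T\<close> keeps all symmetric differences, preserves evenness and sends \<open>T\<close> to
  the empty set.\<close>

lemma card_edges_even_le:
  assumes fin: "finite X" and S: "\<S> \<subseteq> Pow X" and even: "\<And>A. A \<in> \<S> \<Longrightarrow> even (card A)"
    and ne: "\<S> \<noteq> {}"
  shows "card (inclusion_graph_edges \<S>) \<le> (vc_dim_c_star_even X \<S> choose 2) * card \<S>"
proof -
  have finS: "finite \<S>" using S fin by (meson finite_Pow_iff finite_subset)
  have fins: "finite B" if "B \<in> \<S>" for B using that S fin by (auto intro: finite_subset)
  have "vc_dim_c_star_even X \<S> = Min ((\<lambda>A. vc_dim_c X (twisting \<S> A)) ` \<S>)"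
    unfolding vc_dim_c_star_even_def by (simp add: setcompr_eq_image)
  also have "\<dots> \<in> (\<lambda>A. vc_dim_c X (twisting \<S> A)) ` \<S>"
    using finS ne by (intro Min_in) auto
  finally have "vc_dim_c_star_even X \<S> \<in> (\<lambda>A. vc_dim_c X (twisting \<S> A)) ` \<S>" .
  then obtain T where T: "T \<in> \<S>" and d: "vc_dim_c_star_even X \<S> = vc_dim_c X (twisting \<S> T)"
    by blast
  have "card (inclusion_graph_edges \<S>) \<le> card (inclusion_graph_edges (twisting \<S> T))"
    unfolding twisting_def
    by (rule card_edges_le_image[OF finS inj_sym_diff]) (simp only: sym_diff_sym_diff_cancel)
  also have "\<dots> \<le> (vc_dim_c X (twisting \<S> T) choose 2) * card (twisting \<S> T)"
  proof (rule card_edges_pointed_even_le[OF fin])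
    show "twisting \<S> T \<subseteq> Pow X" using S T unfolding twisting_def by auto
    show "{} \<in> twisting \<S> T" using T unfolding twisting_def by (auto intro!: image_eqI[of _ _ T])
    fix B assume "B \<in> twisting \<S> T"
    then obtain C where "C \<in> \<S>" "B = sym_diff C T" unfolding twisting_def by blast
    then show "even (card B)" using even_card_sym_diff[OF fins fins, of C T] T even by simp
  qed
  also have "card (twisting \<S> T) = card \<S>"
    unfolding twisting_def by (rule card_image[OF inj_sym_diff])
  finally show ?thesis unfolding d .
qed

section \<open>Removing evenness by lifting\<close>

text \<open>Lifting set by set presents the lifted family as an image, to which the transfer of
  edges along injective maps applies.\<close>

definition lift_set :: "'a set \<Rightarrow> 'a option set" where
  "lift_set A = (if even (card A) then Some ` A else insert None (Some ` A))"

lemma lifting_eq_image: "lifting \<S> = lift_set ` \<S>"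
  unfolding lifting_def lift_set_def by auto

lemma Some_mem_lift_set [simp]: "Some x \<in> lift_set A \<longleftrightarrow> x \<in> A"
  unfolding lift_set_def by auto

lemma inj_lift_set: "inj_on lift_set \<S>"
  by (rule inj_onI) (metis Some_mem_lift_set subsetI subset_antisym)

lemma finite_lift_set: "finite A \<Longrightarrow> finite (lift_set A)"
  unfolding lift_set_def by simp

lemma even_card_lift_set: "finite A \<Longrightarrow> even (card (lift_set A))"
  unfolding lift_set_def by (auto simp: card_image card_insert_if)

text \<open>The new element raises the distance to at most 3, and lifted sets have even size, so
  their distance is even and hence at most 2. Old differences survive, so it is not 0.\<close>

lemma lift_set_adjacent:
  assumes "finite A" "finite B" "1 \<le> card (sym_diff A B)" "card (sym_diff A B) \<le> 2"
  shows "1 \<le> card (sym_diff (lift_set A) (lift_set B)) \<and>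
    card (sym_diff (lift_set A) (lift_set B)) \<le> 2"
proof -
  let ?D = "sym_diff (lift_set A) (lift_set B)"
  have finD: "finite ?D" using assms(1,2) by (simp add: finite_lift_set)
  have sub: "Some ` sym_diff A B \<subseteq> ?D" by auto
  have "?D \<subseteq> insert None (Some ` sym_diff A B)"
  proof
    fix x assume "x \<in> ?D"
    then show "x \<in> insert None (Some ` sym_diff A B)" by (cases x) auto
  qed
  then have "card ?D \<le> card (insert None (Some ` sym_diff A B))"
    using assms(1,2) by (intro card_mono) auto
  also have "\<dots> \<le> Suc (card (sym_diff A B))"
    using assms(1,2) by (simp add: card_insert_if card_image)
  finally have "card ?D \<le> 3" using assms(4) by simp
  moreover have "even (card ?D)"
    using assms(1,2) by (simp add: even_card_sym_diff finite_lift_set even_card_lift_set)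
  moreover have "1 \<le> card ?D"
    using assms(3) card_mono[OF finD sub] by (simp add: card_image)
  ultimately show ?thesis by presburger
qed

theorem theorem1:
  fixes X :: "'a set" and \<S> :: "'a set set" and m d :: nat
  assumes "finite X" and "card X = m"
    and "\<S> \<subseteq> Pow X"
    and "d = clique_vc_dim X \<S>"
  shows "real (card (inclusion_graph_edges \<S>)) / real (card \<S>) \<le> real (d choose 2)"
proof (cases "\<S> = {}")
  case False
  have finS: "finite \<S>" using assms by (meson finite_Pow_iff finite_subset)
  have fins: "finite B" if "B \<in> \<S>" for B using that assms by (auto intro: finite_subset)
  have "card (inclusion_graph_edges \<S>) \<le> card (inclusion_graph_edges (lifting \<S>))"
    unfolding lifting_eq_image
    by (rule card_edges_le_image[OF finS inj_lift_set]) (intro lift_set_adjacent fins)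
  also have "\<dots> \<le> (d choose 2) * card (lifting \<S>)"
    unfolding assms(4) clique_vc_dim_def
  proof (rule card_edges_even_le)
    show "finite (lifting_ground X)" using assms(1) by (simp add: lifting_ground_def)
    show "lifting \<S> \<subseteq> Pow (lifting_ground X)"
      using assms(3) unfolding lifting_eq_image lifting_ground_def lift_set_def by auto
    show "even (card A)" if "A \<in> lifting \<S>" for A
      using that fins unfolding lifting_eq_image by (auto intro: even_card_lift_set)
    show "lifting \<S> \<noteq> {}" using False by (simp add: lifting_eq_image)
  qed
  also have "card (lifting \<S>) = card \<S>"
    unfolding lifting_eq_image by (rule card_image[OF inj_lift_set])
  finally have "real (card (inclusion_graph_edges \<S>)) \<le> real (d choose 2) * real (card \<S>)"
    by (metis of_nat_le_iff of_nat_mult)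
  moreover have "0 < real (card \<S>)" using finS False by (simp add: card_gt_0_iff)
  ultimately show ?thesis by (simp add: divide_le_eq)
\<comment> \<open>For the empty family the quotient is 0, as division by zero yields zero.\<close>
qed simp

end
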